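(* Let $p$ be a prime. Then $ESL_2(\mathbb{F}_p)\cong SL_2(\mathbb{F}_p)\rtimes \mathbb{C}_2$, where $\mathbb{C}_2$ is the cyclic group of order $2$ generated by the reflection $\begin{pmatrix} -1 & 0\\ 0 & 1\end{pmatrix}$, this involution inducing an automorphism in $\operatorname{Aut}(SL_2(\mathbb{F}_p))$. The subgroup $SL_2(\mathbb{F}_p)$ has index $2$ in $ESL_2(\mathbb{F}_p)$, and hence is normal.
   Context: $ESL_2(\mathbb{F}_p)=\{M\in GL_2(\mathbb{F}_p) : \det M=\pm 1\}$ is the extended special linear group, and $\mathbb{F}_p$ is the field with $p$ elements.
   Formalization: For p = 2 the reflection is the identity and ESL_2 = SL_2, so the claims that C_2 has order 2 and that SL_2 has index 2 are stated only for p ≠ 2; for p = 2, C_2 is read as the trivial group generated by the reflection. *)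

theory Defs
  imports
    "HOL-Analysis.Determinants"
    "HOL-Algebra.Bij"
    "HOL-Algebra.Elementary_Groups"
    "HOL-Computational_Algebra.Primes"
begin

text \<open>The field with \<open>p\<close> elements is represented by an arbitrary type \<open>'k\<close> of class
  \<^class>\<open>field\<close> with \<open>CARD('k) = p\<close>, \<open>p\<close> prime; the type \<open>mod_ring\<close> of integers modulo \<open>p\<close>
  is one such type.\<close>

definition GL2 :: "('k::field ^ 2 ^ 2) monoid" where
  "GL2 = \<lparr>carrier = {A. invertible A}, monoid.mult = (**), one = mat 1\<rparr>"

definition SL2 :: "('k::field ^ 2 ^ 2) monoid" where
  "SL2 = GL2\<lparr>carrier := {A \<in> carrier GL2. det A = 1}\<rparr>"

definition ESL2 :: "('k::field ^ 2 ^ 2) monoid" where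
  "ESL2 = GL2\<lparr>carrier := {A \<in> carrier GL2. det A = 1 \<or> det A = - 1}\<rparr>"

definition reflection :: "'k::field ^ 2 ^ 2" where
  "reflection = vector [vector [- 1, 0], vector [0, 1]]"

text \<open>In characteristic 2 the reflection is the identity matrix, so this group is then trivial; it
  has order 2 in every other characteristic.\<close>

definition reflection_group :: "('k::field ^ 2 ^ 2) monoid" where
  "reflection_group = subgroup_generated ESL2 {reflection}"

text \<open>Automorphisms in \<^const>\<open>auto\<close> are extensional functions, hence the restriction to the
  carrier of \<^const>\<open>SL2\<close>.\<close>

definition conj_SL2 :: "'k::field ^ 2 ^ 2 \<Rightarrow> 'k ^ 2 ^ 2 \<Rightarrow> 'k ^ 2 ^ 2" where
  "conj_SL2 h = (\<lambda>A \<in> carrier SL2. h \<otimes>\<^bsub>ESL2\<^esub> A \<otimes>\<^bsub>ESL2\<^esub> inv\<^bsub>ESL2\<^esub> h)"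

text \<open>The external semidirect product of \<open>N\<close> and \<open>H\<close>; it is a group when \<open>N\<close> and \<open>H\<close> are
  groups and \<open>\<phi> \<in> hom H (AutoGroup N)\<close>.\<close>

definition semidirect_product ::
  "('a, 'm) monoid_scheme \<Rightarrow> ('b, 'n) monoid_scheme \<Rightarrow> ('b \<Rightarrow> 'a \<Rightarrow> 'a) \<Rightarrow> ('a \<times> 'b) monoid" where
  "semidirect_product N H \<phi> =
     \<lparr>carrier = carrier N \<times> carrier H,
      monoid.mult = (\<lambda>(n, h) (n', h'). (n \<otimes>\<^bsub>N\<^esub> \<phi> h n', h \<otimes>\<^bsub>H\<^esub> h')),
      one = (\<one>\<^bsub>N\<^esub>, \<one>\<^bsub>H\<^esub>)\<rparr>"

end

theory Submission
  imports Defs "HOL-Number_Theory.Residues"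
begin

text \<open>The reflection \<open>r\<close> is an involution of determinant \<open>-1\<close>. So \<open>{1, r}\<close> is a complement of
  the kernel \<open>SL2\<close> of the determinant on \<open>ESL2\<close>, and a group is the semidirect product of a
  normal subgroup and a complement. No case distinction on the characteristic is needed for this:
  if \<open>1 = -1\<close>, then \<open>r = 1\<close>.\<close>

section \<open>Complements of normal subgroups\<close>

context group
begin

lemma conj_mult:
  assumes "h \<in> carrier G" "a \<in> carrier G" "b \<in> carrier G"
  shows "h \<otimes> (a \<otimes> b) \<otimes> inv h = (h \<otimes> a \<otimes> inv h) \<otimes> (h \<otimes> b \<otimes> inv h)"
proof -
  have "inv h \<otimes> (h \<otimes> (b \<otimes> inv h)) = b \<otimes> inv h"
    using assms by (simp flip: m_assoc)
  then show ?thesis using assms by (simp add: m_assoc)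
qed

lemma conj_comp:
  assumes "g \<in> carrier G" "h \<in> carrier G" "a \<in> carrier G"
  shows "g \<otimes> (h \<otimes> a \<otimes> inv h) \<otimes> inv g = (g \<otimes> h) \<otimes> a \<otimes> inv (g \<otimes> h)"
  using assms by (simp add: inv_mult_group m_assoc)

text \<open>By normality, conjugation by \<open>h\<close> and by \<open>inv h\<close> both map
  \<open>N\<close> into itself, and \<open>conj_comp\<close> makes them mutually inverse
  there.\<close>

lemma conj_restrict_in_auto:
  assumes "N \<lhd> G" "h \<in> carrier G"
  shows "(\<lambda>a\<in>N. h \<otimes> a \<otimes> inv h) \<in> auto (G\<lparr>carrier := N\<rparr>)"
proof -
  interpret N: normal N G by fact
  let ?c = "\<lambda>h a. h \<otimes> a \<otimes> inv h"
  have cancel: "?c (inv g) (?c g a) = a" "?c g (?c (inv g) a) = a"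
    if "g \<in> carrier G" "a \<in> N" for g a
    using that conj_comp[of "inv g" g a] conj_comp[of g "inv g" a] N.mem_carrier by auto
  have "bij_betw (?c h) N N"
    by (rule bij_betw_byWitness[where f' = "?c (inv h)"])
      (use assms cancel N.inv_op_closed2[of h] N.inv_op_closed2[of "inv h"] in auto)
  then have "bij_betw (\<lambda>a\<in>N. ?c h a) N N"
    by (simp cong: bij_betw_cong)
  moreover have "(\<lambda>a\<in>N. ?c h a) \<in> hom (G\<lparr>carrier := N\<rparr>) (G\<lparr>carrier := N\<rparr>)"
    using assms N.inv_op_closed2 N.mem_carrier conj_mult by (auto intro!: homI)
  ultimately show ?thesis by (simp add: auto_def Bij_def)
qed

lemma conj_restrict_hom_AutoGroup:
  assumes "N \<lhd> G" "subgroup H G"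
  shows "(\<lambda>h. \<lambda>a\<in>N. h \<otimes> a \<otimes> inv h) \<in> hom (G\<lparr>carrier := H\<rparr>) (AutoGroup (G\<lparr>carrier := N\<rparr>))"
    (is "?\<phi> \<in> _")
proof (rule homI)
  interpret N: normal N G by fact
  have H: "h \<in> carrier G" if "h \<in> H" for h
    using assms(2) that by (rule subgroup.mem_carrier)
  have auto: "?\<phi> h \<in> auto (G\<lparr>carrier := N\<rparr>)" if "h \<in> H" for h
    using conj_restrict_in_auto assms(1) H that by blast
  show "?\<phi> h \<in> carrier (AutoGroup (G\<lparr>carrier := N\<rparr>))" if "h \<in> carrier (G\<lparr>carrier := H\<rparr>)" for h
    using that auto by (simp add: AutoGroup_def)
  fix g h assume "g \<in> carrier (G\<lparr>carrier := H\<rparr>)" "h \<in> carrier (G\<lparr>carrier := H\<rparr>)"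
  then have gh: "g \<in> H" "h \<in> H" by auto
  have "?\<phi> (g \<otimes> h) = compose N (?\<phi> g) (?\<phi> h)"
    using gh H N.mem_carrier N.inv_op_closed2 conj_comp by (auto simp: compose_def fun_eq_iff)
  \<comment> \<open>The multiplication of \<open>BijGroup\<close> is itself restricted to
    \<open>Bij N\<close>, so it unfolds to \<open>compose N\<close> only for members.\<close>
  moreover have "?\<phi> g \<in> Bij N" "?\<phi> h \<in> Bij N"
    using auto[OF gh(1)] auto[OF gh(2)] by (simp_all add: auto_def)
  ultimately show "?\<phi> (g \<otimes>\<^bsub>G\<lparr>carrier := H\<rparr>\<^esub> h)
      = ?\<phi> g \<otimes>\<^bsub>AutoGroup (G\<lparr>carrier := N\<rparr>)\<^esub> ?\<phi> h"
    by (simp add: AutoGroup_def BijGroup_def)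
qed

text \<open>If \<open>n h = n' h'\<close>, then \<open>inv n' n = h' inv h\<close> lies in both
  \<open>N\<close> and \<open>H\<close>, hence is \<open>\<one>\<close>. This unique factorization
  yields both the semidirect product and the count of cosets.\<close>

lemma complement_bij_betw:
  assumes "subgroup N G" "subgroup H G" "N \<inter> H = {\<one>}" "carrier G = N <#> H"
  shows "bij_betw (\<lambda>(n, h). n \<otimes> h) (N \<times> H) (carrier G)"
proof (rule bij_betw_imageI)
  interpret N: subgroup N G by fact
  interpret H: subgroup H G by fact
  show "inj_on (\<lambda>(n, h). n \<otimes> h) (N \<times> H)"
  proof (rule inj_onI, clarify)
    fix n h n' h' assume mem: "n \<in> N" "h \<in> H" "n' \<in> N" "h' \<in> H" and eq: "n \<otimes> h = n' \<otimes> h'"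
    note c = N.mem_carrier[OF mem(1)] H.mem_carrier[OF mem(2)]
      N.mem_carrier[OF mem(3)] H.mem_carrier[OF mem(4)]
    have "inv n' \<otimes> n = inv n' \<otimes> (n \<otimes> h) \<otimes> inv h"
      using c by (simp add: m_assoc)
    also have "\<dots> = h' \<otimes> inv h"
      using c by (simp add: eq) (simp flip: m_assoc)
    finally have *: "inv n' \<otimes> n = h' \<otimes> inv h" .
    then have "inv n' \<otimes> n \<in> N \<inter> H"
      using mem by (metis IntI N.m_closed N.m_inv_closed H.m_closed H.m_inv_closed)
    then have "inv n' \<otimes> n = \<one>" using assms(3) by blast
    then have "n = n'" using c inv_solve_left' by (metis r_one inv_solve_left one_closed)
    with eq c show "n = n' \<and> h = h'" by simp
  qed
  show "(\<lambda>(n, h). n \<otimes> h) ` (N \<times> H) = carrier G"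
    unfolding assms(4) by (force simp: set_mult_def)
qed

text \<open>The map \<open>(n, h) \<mapsto> n h\<close> is multiplicative because
  \<open>n h n' h' = n (h n' inv h) (h h')\<close>. Its inverse is the isomorphism from
  \<open>G\<close>.\<close>

lemma complement_iso_semidirect_product:
  assumes "N \<lhd> G" "subgroup H G" "N \<inter> H = {\<one>}" "carrier G = N <#> H"
  shows "G \<cong> semidirect_product (G\<lparr>carrier := N\<rparr>) (G\<lparr>carrier := H\<rparr>) (\<lambda>h. \<lambda>a\<in>N. h \<otimes> a \<otimes> inv h)"
    (is "_ \<cong> ?S")
proof -
  interpret N: normal N G by fact
  interpret H: subgroup H G by fact
  let ?m = "\<lambda>(n, h). n \<otimes> h"
  have bij: "bij_betw ?m (carrier ?S) (carrier G)"
    using complement_bij_betw[OF N.is_subgroup assms(2-4)] by (simp add: semidirect_product_def)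
  have mult: "?m (x \<otimes>\<^bsub>?S\<^esub> y) = ?m x \<otimes> ?m y" and closed: "x \<otimes>\<^bsub>?S\<^esub> y \<in> carrier ?S"
    if "x \<in> carrier ?S" "y \<in> carrier ?S" for x y
  proof -
    obtain n h n' h' where xy: "x = (n, h)" "y = (n', h')" by fastforce
    with that have mem: "n \<in> N" "h \<in> H" "n' \<in> N" "h' \<in> H"
      by (auto simp: semidirect_product_def)
    then show "x \<otimes>\<^bsub>?S\<^esub> y \<in> carrier ?S"
      using xy N.inv_op_closed2 by (auto simp: semidirect_product_def)
    have "inv h \<otimes> (h \<otimes> h') = h'"
      using mem by (simp flip: m_assoc)
    then show "?m (x \<otimes>\<^bsub>?S\<^esub> y) = ?m x \<otimes> ?m y"
      using xy mem by (simp add: semidirect_product_def m_assoc)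
  qed
  let ?i = "inv_into (carrier ?S) ?m"
  have i: "?i u \<in> carrier ?S" "?m (?i u) = u" if "u \<in> carrier G" for u
    using that bij_betw_imp_surj_on[OF bij] inv_into_into[of u ?m] f_inv_into_f[of u ?m]
    by simp_all
  \<comment> \<open>As \<open>?m\<close> is injective, it is enough that the product of the
    preimages is a preimage of \<open>u \<otimes> v\<close>. This avoids showing first that
    \<open>?S\<close> is a group.\<close>
  have "?i (u \<otimes> v) = ?i u \<otimes>\<^bsub>?S\<^esub> ?i v" if "u \<in> carrier G" "v \<in> carrier G" for u v
  proof (rule inv_into_f_eq)
    show "inj_on ?m (carrier ?S)" using bij by (rule bij_betw_imp_inj_on)
    show "?i u \<otimes>\<^bsub>?S\<^esub> ?i v \<in> carrier ?S" using that by (intro closed i)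
    show "?m (?i u \<otimes>\<^bsub>?S\<^esub> ?i v) = u \<otimes> v" by (simp only: mult i that)
  qed
  then have "?i \<in> iso G ?S"
    by (intro isoI homI i bij_betw_inv_into[OF bij])
  then show ?thesis by (auto simp: is_iso_def)
qed

text \<open>\<open>H\<close> is a transversal: every right coset of \<open>N\<close> contains
  exactly one element of \<open>H\<close>.\<close>

lemma complement_card_rcosets:
  assumes "subgroup N G" "subgroup H G" "N \<inter> H = {\<one>}" "carrier G = N <#> H"
  shows "card (rcosets N) = card H"
proof -
  interpret N: subgroup N G by fact
  interpret H: subgroup H G by fact
  have "inj_on (\<lambda>h. N #> h) H"
  proof (rule inj_onI)
    fix h h' assume mem: "h \<in> H" "h' \<in> H" and "N #> h = N #> h'"
    then have "h \<in> N #> h'" using rcos_self[OF H.mem_carrier assms(1), of h] by simp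
    then obtain n where n: "n \<in> N" "h = n \<otimes> h'" by (auto simp: r_coset_def)
    \<comment> \<open>Both pairs multiply to \<open>h\<close>, so unique factorization identifies
      them.\<close>
    have "(\<one>, h) = (n, h')"
      using complement_bij_betw[OF assms] n mem
      by (intro inj_onD[of "\<lambda>(n, h). n \<otimes> h" "N \<times> H"]) (auto simp: bij_betw_def)
    then show "h = h'" by simp
  qed
  moreover have "(\<lambda>h. N #> h) ` H = rcosets N"
  proof -
    have "N #> x \<in> (\<lambda>h. N #> h) ` H" if "x \<in> carrier G" for x
    proof -
      from that assms(4) obtain n h where nh: "n \<in> N" "h \<in> H" "x = n \<otimes> h"
        by (auto simp: set_mult_def)
      then have "x \<in> N #> h" by (auto simp: r_coset_def)
      then have "N #> h = N #> x"
        using repr_independence assms(1) nh(2) by simp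
      with nh show ?thesis by blast
    qed
    moreover have "N #> h \<in> rcosets N" if "h \<in> H" for h
      using rcosetsI[OF N.subset H.mem_carrier[OF that]] .
    ultimately show ?thesis unfolding RCOSETS_def by blast
  qed
  ultimately show ?thesis by (metis card_image)
qed

end

section \<open>The extended special linear group\<close>

text \<open>Invertibility drops out of the carrier because \<open>1\<close> and \<open>- 1\<close>
  are nonzero in a field.\<close>

lemma ESL2_simps:
  "carrier (ESL2 :: ('k::field ^ 2 ^ 2) monoid) = {A. det A = 1 \<or> det A = - 1}"
  "monoid.mult (ESL2 :: ('k ^ 2 ^ 2) monoid) = (**)"
  "one (ESL2 :: ('k ^ 2 ^ 2) monoid) = mat 1"
  by (auto simp: ESL2_def GL2_def invertible_det_nz)

lemma carrier_SL2: "carrier (SL2 :: ('k::field ^ 2 ^ 2) monoid) = {A. det A = 1}"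
  by (auto simp: SL2_def GL2_def invertible_det_nz)

text \<open>This is the shape \<open>G\<lparr>carrier := N\<rparr>\<close> in which the lemmas on
  complements speak of the normal subgroup.\<close>

lemma SL2_eq: "(SL2 :: ('k::field ^ 2 ^ 2) monoid) = ESL2\<lparr>carrier := carrier SL2\<rparr>"
  by (simp add: SL2_def ESL2_def)

lemma group_ESL2: "group (ESL2 :: ('k::field ^ 2 ^ 2) monoid)"
proof (rule groupI)
  fix A :: "'k ^ 2 ^ 2" assume A: "A \<in> carrier ESL2"
  then have "invertible A" by (auto simp: ESL2_simps invertible_det_nz)
  then obtain B where B: "B ** A = mat 1" by (auto simp: invertible_def)
  then have "det B * det A = 1" by (metis det_I det_mul)
  with A have "det B = 1 \<or> det B = - 1"
    by (auto simp: ESL2_simps minus_equation_iff)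
  with B show "\<exists>B\<in>carrier ESL2. B \<otimes>\<^bsub>ESL2\<^esub> A = \<one>\<^bsub>ESL2\<^esub>"
    by (auto simp: ESL2_simps)
qed (auto simp: ESL2_simps det_mul matrix_mul_assoc)

text \<open>The determinants of \<open>x\<close> and its inverse cancel in that of a conjugate.
  Arguing this way rather than from index 2 covers characteristic 2 as well.\<close>

lemma SL2_normal: "carrier (SL2 :: ('k::field ^ 2 ^ 2) monoid) \<lhd> ESL2"
proof -
  interpret group "ESL2 :: ('k ^ 2 ^ 2) monoid" by (rule group_ESL2)
  have det_inv: "det x * det (inv\<^bsub>ESL2\<^esub> x) = 1" if "x \<in> carrier ESL2" for x :: "'k ^ 2 ^ 2"
    using r_inv[OF that] by (metis ESL2_simps(2,3) det_I det_mul)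
  show ?thesis
    unfolding normal_inv_iff
  proof (intro conjI ballI)
    show "subgroup (carrier (SL2 :: ('k ^ 2 ^ 2) monoid)) ESL2"
    proof (rule subgroupI)
      fix A :: "'k ^ 2 ^ 2" assume "A \<in> carrier SL2"
      then show "inv\<^bsub>ESL2\<^esub> A \<in> carrier SL2"
        using det_inv[of A] by (simp add: carrier_SL2 ESL2_simps)
    qed (auto simp: carrier_SL2 ESL2_simps det_mul intro: exI[of _ "mat 1"])
    fix x h :: "'k ^ 2 ^ 2" assume "x \<in> carrier ESL2" "h \<in> carrier SL2"
    then show "x \<otimes>\<^bsub>ESL2\<^esub> h \<otimes>\<^bsub>ESL2\<^esub> inv\<^bsub>ESL2\<^esub> x \<in> carrier SL2"
      using det_inv[of x] by (simp add: carrier_SL2 ESL2_simps(2) det_mul)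
  qed
qed

lemma det_reflection: "det (reflection :: 'k::field ^ 2 ^ 2) = - 1"
  by (simp add: det_2 reflection_def)

lemma reflection_involution: "reflection ** reflection = (mat 1 :: 'k::field ^ 2 ^ 2)"
  by (simp add: vec_eq_iff forall_2 matrix_matrix_mult_def sum_2 reflection_def mat_def)

text \<open>This decides whether \<open>{mat 1, reflection}\<close> has one or two elements.\<close>

lemma reflection_eq_one_iff: "reflection = (mat 1 :: 'k::field ^ 2 ^ 2) \<longleftrightarrow> (- 1 :: 'k) = 1"
  by (simp add: vec_eq_iff forall_2 reflection_def mat_def)

lemma subgroup_reflection: "subgroup {mat 1, reflection :: 'k::field ^ 2 ^ 2} ESL2"
proof -
  interpret group "ESL2 :: ('k ^ 2 ^ 2) monoid" by (rule group_ESL2)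
  have r: "(reflection :: 'k ^ 2 ^ 2) \<in> carrier ESL2"
    by (simp add: ESL2_simps det_reflection)
  then have "inv\<^bsub>ESL2\<^esub> (reflection :: 'k ^ 2 ^ 2) = reflection"
    by (intro inv_equality) (simp_all add: ESL2_simps(2,3) reflection_involution)
  with r show ?thesis
    using inv_one one_closed
    by (intro subgroupI) (auto simp: ESL2_simps(2,3) reflection_involution)
qed

lemma reflection_group_eq:
  "(reflection_group :: ('k::field ^ 2 ^ 2) monoid) = ESL2\<lparr>carrier := {mat 1, reflection}\<rparr>"
proof -
  interpret group "ESL2 :: ('k ^ 2 ^ 2) monoid" by (rule group_ESL2)
  have "generate ESL2 {reflection :: 'k ^ 2 ^ 2} = {mat 1, reflection}"
  proof
    show "generate ESL2 {reflection :: 'k ^ 2 ^ 2} \<subseteq> {mat 1, reflection}"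
      by (rule generate_subgroup_incl[OF _ subgroup_reflection]) simp
    show "{mat 1, reflection} \<subseteq> generate ESL2 {reflection :: 'k ^ 2 ^ 2}"
      using generate.one[of ESL2 "{reflection :: 'k ^ 2 ^ 2}"]
      by (simp add: ESL2_simps(3) generate.incl)
  qed
  \<comment> \<open>\<open>subgroup_generated\<close> intersects the generating set with the carrier
    before generating.\<close>
  moreover have "carrier ESL2 \<inter> {reflection :: 'k ^ 2 ^ 2} = {reflection}"
    by (simp add: ESL2_simps det_reflection)
  ultimately show ?thesis
    by (simp add: reflection_group_def subgroup_generated_def)
qed

text \<open>If \<open>reflection\<close> has determinant \<open>1\<close>, then
  \<open>- 1 = 1\<close>, and so \<open>reflection\<close> is already \<open>mat 1\<close>.\<close>

lemma SL2_Int_reflection: "carrier SL2 \<inter> {mat 1, reflection :: 'k::field ^ 2 ^ 2} = {\<one>\<^bsub>ESL2\<^esub>}"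
  using reflection_eq_one_iff[where ?'k = 'k]
  by (auto simp: carrier_SL2 ESL2_simps det_reflection)

text \<open>A matrix \<open>A\<close> of determinant \<open>- 1\<close> factors as
  \<open>(A ** reflection) ** reflection\<close>, whose first factor has determinant
  \<open>1\<close>.\<close>

lemma ESL2_eq_SL2_mult_reflection:
  "carrier (ESL2 :: ('k::field ^ 2 ^ 2) monoid) = carrier SL2 <#>\<^bsub>ESL2\<^esub> {mat 1, reflection}"
proof
  show "carrier (ESL2 :: ('k ^ 2 ^ 2) monoid) \<subseteq> carrier SL2 <#>\<^bsub>ESL2\<^esub> {mat 1, reflection}"
  proof
    fix A :: "'k ^ 2 ^ 2" assume "A \<in> carrier ESL2"
    then consider "det A = 1" | "det A = - 1" by (auto simp: ESL2_simps)
    then show "A \<in> carrier SL2 <#>\<^bsub>ESL2\<^esub> {mat 1, reflection}"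
    proof cases
      case 1
      then show ?thesis by (auto simp: set_mult_def carrier_SL2 ESL2_simps)
    next
      case 2
      then have "det (A ** reflection) = 1" by (simp add: det_mul det_reflection)
      moreover have "A = A ** reflection ** reflection"
        by (simp add: reflection_involution flip: matrix_mul_assoc)
      ultimately show ?thesis by (auto simp: set_mult_def carrier_SL2 ESL2_simps)
    qed
  qed
qed (auto simp: set_mult_def carrier_SL2 ESL2_simps det_mul det_reflection)

text \<open>From \<open>- 1 = 1\<close> follows \<open>2 = 0\<close>, so the characteristic is 2. It
  divides the prime \<open>CARD('k)\<close>, which is then 2.\<close>

lemma minus_one_neq_one:
  assumes "prime CARD('k::field)" "CARD('k) \<noteq> 2"
  shows "(- 1 :: 'k) \<noteq> 1"
proof
  assume "(- 1 :: 'k) = 1"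
  then have "of_nat 2 = (0 :: 'k)"
    by (metis add.right_inverse of_nat_numeral one_add_one)
  then have "CHAR('k) dvd 2"
    by (simp only: of_nat_eq_0_iff_char_dvd)
  then have "CHAR('k) = 2"
    using two_is_prime_nat CHAR_not_1[where ?'a = 'k] by (auto simp: prime_nat_iff)
  with assms show False
    using CHAR_dvd_CARD[where ?'a = 'k] primes_dvd_imp_eq two_is_prime_nat by metis
qed

text \<open>Order and index are claimed for odd \<open>p\<close> only: for \<open>p = 2\<close> the
  reflection is \<open>mat 1\<close> and \<open>ESL2\<close> coincides with \<open>SL2\<close>, so
  both numbers are 1. The other conjuncts hold for every prime.\<close>

theorem mainTheorem3:
  fixes p :: nat
  assumes "prime p"
    and "CARD('k::field) = p"
  shows "cyclic_group (reflection_group :: ('k ^ 2 ^ 2) monoid)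
    \<and> (p \<noteq> 2 \<longrightarrow> order (reflection_group :: ('k ^ 2 ^ 2) monoid) = 2)
    \<and> conj_SL2 (reflection :: 'k ^ 2 ^ 2) \<in> auto SL2
    \<and> conj_SL2 \<in> hom (reflection_group :: ('k ^ 2 ^ 2) monoid) (AutoGroup SL2)
    \<and> (ESL2 :: ('k ^ 2 ^ 2) monoid) \<cong> semidirect_product SL2 (reflection_group :: ('k ^ 2 ^ 2) monoid) conj_SL2
    \<and> (p \<noteq> 2 \<longrightarrow> card (rcosets\<^bsub>ESL2\<^esub> (carrier (SL2 :: ('k ^ 2 ^ 2) monoid))) = 2)
    \<and> carrier (SL2 :: ('k ^ 2 ^ 2) monoid) \<lhd> ESL2"
proof -
  interpret E: group "ESL2 :: ('k ^ 2 ^ 2) monoid" by (rule group_ESL2)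
  let ?N = "carrier (SL2 :: ('k ^ 2 ^ 2) monoid)" and ?H = "{mat 1, reflection :: 'k ^ 2 ^ 2}"
  note complement = subgroup_reflection SL2_Int_reflection ESL2_eq_SL2_mult_reflection
  have conj: "conj_SL2 = (\<lambda>h. \<lambda>A\<in>?N. h \<otimes>\<^bsub>ESL2\<^esub> A \<otimes>\<^bsub>ESL2\<^esub> inv\<^bsub>ESL2\<^esub> h)"
    by (simp add: conj_SL2_def fun_eq_iff)
  have card: "card ?H = 2" if "p \<noteq> 2"
    using minus_one_neq_one[where ?'k = 'k] reflection_eq_one_iff[where ?'k = 'k] assms that
    by auto
  have "cyclic_group (reflection_group :: ('k ^ 2 ^ 2) monoid)"
    unfolding reflection_group_def by (rule E.cyclic_group_generated)
  moreover have "order (reflection_group :: ('k ^ 2 ^ 2) monoid) = 2" if "p \<noteq> 2"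
    using card[OF that] by (simp add: order_def reflection_group_eq)
  moreover have "conj_SL2 (reflection :: 'k ^ 2 ^ 2) \<in> auto SL2"
    using E.conj_restrict_in_auto[OF SL2_normal, of reflection]
    by (simp add: conj ESL2_simps(1) det_reflection flip: SL2_eq)
  moreover have "conj_SL2 \<in> hom (reflection_group :: ('k ^ 2 ^ 2) monoid) (AutoGroup SL2)"
    using E.conj_restrict_hom_AutoGroup[OF SL2_normal subgroup_reflection]
    by (simp add: conj reflection_group_eq flip: SL2_eq)
  moreover have "(ESL2 :: ('k ^ 2 ^ 2) monoid) \<cong>
      semidirect_product SL2 (reflection_group :: ('k ^ 2 ^ 2) monoid) conj_SL2"
    using E.complement_iso_semidirect_product[OF SL2_normal complement]
    by (simp only: conj reflection_group_eq flip: SL2_eq)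
  \<comment> \<open>The index of \<open>SL2\<close> is the cardinality of its complement
    \<open>?H\<close>.\<close>
  moreover have "card (rcosets\<^bsub>ESL2\<^esub> ?N) = 2" if "p \<noteq> 2"
    using E.complement_card_rcosets[OF normal_imp_subgroup[OF SL2_normal] complement] card[OF that]
    by (rule trans)
  ultimately show ?thesis using SL2_normal by blast
qed

end
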